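(* Let $\mathcal P_d=(P,R,f)$ be a DPS instance whose graph $(P,R)$ is a star. Then its poly density is $d=\sum_{e\in R}\frac{1}{f_e}$.
   Context: A Decision Polyamorous Scheduling (DPS) instance $(P,R,f)$ consists of a finite simple undirected graph $(P,R)$ with integer frequencies $f:R\to\mathbb N$, $f_e=f(e)$. Let $\mathcal M$ be the set of inclusion-maximal matchings of $(P,R)$ and $\mathcal Z$ the set of weightings $z:R\to[0,1]$ with $\sum_{e\in R}z_e=1$. The poly density is $d=\max_{z\in\mathcal Z}\left(\max_{M\in\mathcal M}\sum_{e\in M} z_e f_e\right)^{-1}$. *)

theory Defs
  imports Complex_Main "HOL-Library.FuncSet" "HOL-Library.Disjoint_Sets"
begin

definition simple_graph :: "'a set \<Rightarrow> 'a set set \<Rightarrow> bool" where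
  "simple_graph P R \<longleftrightarrow> finite P \<and> (\<forall>e\<in>R. e \<subseteq> P \<and> card e = 2)"

text \<open>Frequencies are reciprocated, so they range over the positive integers.\<close>

definition dps_instance :: "'a set \<Rightarrow> 'a set set \<Rightarrow> ('a set \<Rightarrow> nat) \<Rightarrow> bool" where
  "dps_instance P R f \<longleftrightarrow> simple_graph P R \<and> (\<forall>e\<in>R. 0 < f e)"

definition matching :: "'a set set \<Rightarrow> 'a set set \<Rightarrow> bool" where
  "matching R M \<longleftrightarrow> M \<subseteq> R \<and> disjoint M"

definition maximal_matchings :: "'a set set \<Rightarrow> 'a set set set" where
  "maximal_matchings R =
     {M. matching R M \<and> (\<forall>M'. matching R M' \<and> M \<subseteq> M' \<longrightarrow> M' = M)}"

definition weightings :: "'a set set \<Rightarrow> ('a set \<Rightarrow> real) set" where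
  "weightings R = {z. z \<in> R \<rightarrow>\<^sub>E {0..1} \<and> (\<Sum>e\<in>R. z e) = 1}"

text \<open>
  The inner maximum is over a finite set of matchings. The outer one is over the infinite
  set of weightings, where \<open>Max\<close> is unspecified; \<open>GREATEST\<close> denotes the largest
  value that is attained. If \<open>R\<close> is empty there are no weightings and no density.
\<close>

definition poly_density :: "'a set set \<Rightarrow> ('a set \<Rightarrow> nat) \<Rightarrow> real" where
  "poly_density R f =
     (GREATEST d. d \<in> (\<lambda>z. inverse (Max ((\<lambda>M. \<Sum>e\<in>M. z e * real (f e)) ` maximal_matchings R)))
                        ` weightings R)"

definition star_graph :: "'a set \<Rightarrow> 'a set set \<Rightarrow> bool" where
  "star_graph P R \<longleftrightarrow> (\<exists>c\<in>P. R = {{c, v} | v. v \<in> P - {c}})"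

end

theory Submission
  imports Defs
begin

text \<open>
  Any two edges of a star meet, so its maximal matchings are the single edges and the inner
  maximum is \<open>m = Max (z e * f e)\<close>. Summing \<open>z e \<le> m / f e\<close> over the edges gives
  \<open>1 \<le> m * (\<Sum>e. 1 / f e)\<close>, with equality for weights proportional to \<open>1 / f e\<close>.
\<close>

text \<open>Distinct edges through \<open>c\<close> are never disjoint, so a matching has at most
  one edge. Since \<open>R\<close> is nonempty, \<open>{}\<close> extends to some \<open>{e}\<close>
  and is not maximal.\<close>

lemma maximal_matchings_common_vertex:
  assumes c: "\<And>e. e \<in> R \<Longrightarrow> c \<in> e" and ne: "R \<noteq> {}"
  shows "maximal_matchings R = (\<lambda>e. {e}) ` R"
proof -
  have matching_iff: "matching R M \<longleftrightarrow> M = {} \<or> (\<exists>e\<in>R. M = {e})" for M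
  proof
    assume M: "matching R M"
    have "e = e'" if "e \<in> M" "e' \<in> M" for e e'
      using M c that unfolding matching_def disjoint_def by blast
    with M show "M = {} \<or> (\<exists>e\<in>R. M = {e})"
      unfolding matching_def by blast
  qed (auto simp: matching_def disjoint_def)
  show ?thesis
    using ne unfolding maximal_matchings_def matching_iff by blast
qed

text \<open>Isolates what a star contributes: finitely many edges through one vertex.\<close>

lemma poly_density_common_vertex:
  assumes fin: "finite R" and ne: "R \<noteq> {}" and pos: "\<And>e. e \<in> R \<Longrightarrow> 0 < f e"
    and c: "\<And>e. e \<in> R \<Longrightarrow> c \<in> e"
  shows "poly_density R f = (\<Sum>e\<in>R. 1 / real (f e))"
proof -
  define D where "D = (\<Sum>e\<in>R. 1 / real (f e))"
  define m where "m = (\<lambda>z. Max ((\<lambda>e. z e * real (f e)) ` R))"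
  have D_pos: "D > 0"
    unfolding D_def using fin ne pos by (intro sum_pos) auto
  have density: "poly_density R f = (GREATEST d. d \<in> (\<lambda>z. inverse (m z)) ` weightings R)"
    using maximal_matchings_common_vertex[of R c] c ne
    by (simp add: poly_density_def m_def image_image)
  \<comment> \<open>Dividing by \<open>D\<close> normalises the total weight to 1.
    \<open>restrict\<close> makes \<open>z\<close> extensional, as membership in
    \<open>weightings R\<close> demands.\<close>
  define z where "z = restrict (\<lambda>e. 1 / real (f e) / D) R"
  have le_D: "1 / real (f e) \<le> D" if "e \<in> R" for e
    unfolding D_def using fin that by (intro member_le_sum) auto
  have sum_z: "(\<Sum>e\<in>R. z e) = 1"
  proof -
    have "(\<Sum>e\<in>R. z e) = (\<Sum>e\<in>R. 1 / real (f e)) / D"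
      by (simp add: z_def sum_divide_distrib)
    then show ?thesis
      using D_pos by (simp flip: D_def)
  qed
  have "z e \<in> {0..1}" if "e \<in> R" for e
  proof -
    have "1 / real (f e) / D \<le> 1"
      by (subst divide_le_eq_1_pos[OF D_pos]) (rule le_D[OF that])
    then show ?thesis
      using D_pos that by (simp add: z_def)
  qed
  then have "z \<in> R \<rightarrow>\<^sub>E {0..1}"
    unfolding z_def by (intro restrict_PiE_iff[THEN iffD2]) auto
  then have "z \<in> weightings R"
    using sum_z by (simp add: weightings_def)
  moreover have "inverse (m z) = D"
  proof -
    \<comment> \<open>The factor \<open>f e > 0\<close> cancels, so every edge attains the same
      value and the maximum is over a singleton.\<close>
    have "(\<lambda>e. z e * real (f e)) ` R = (\<lambda>e. 1 / D) ` R"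
      using pos by (intro image_cong) (auto simp: z_def)
    then have "(\<lambda>e. z e * real (f e)) ` R = {1 / D}"
      using ne by auto
    then show ?thesis
      unfolding m_def by simp
  qed
  ultimately have attained: "D \<in> (\<lambda>z. inverse (m z)) ` weightings R"
    by (metis imageI)
  have upper: "inverse (m w) \<le> D" if w: "w \<in> weightings R" for w
  proof -
    have "1 = (\<Sum>e\<in>R. w e)"
      using w by (simp add: weightings_def)
    also have "\<dots> \<le> (\<Sum>e\<in>R. m w * (1 / real (f e)))"
    proof (rule sum_mono)
      fix e assume e: "e \<in> R"
      have "w e * real (f e) \<le> m w"
        unfolding m_def using fin e by (intro Max_ge) auto
      then show "w e \<le> m w * (1 / real (f e))"
        using pos[OF e] by (simp add: pos_le_divide_eq)
    qed
    also have "\<dots> = m w * D"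
      by (simp only: D_def sum_distrib_left)
    finally have one_le: "1 \<le> m w * D" .
    \<comment> \<open>The sign must be settled before \<open>1 \<le> m w * D\<close> can be divided
      by \<open>m w\<close>.\<close>
    with D_pos have "m w > 0"
      by (smt (verit) mult_nonpos_nonneg)
    with one_le show ?thesis
      by (simp add: field_simps)
  qed
  show ?thesis
    unfolding density D_def[symmetric]
    \<comment> \<open>An attained upper bound is the greatest element, which pins down
      \<open>GREATEST\<close>.\<close>
    using attained upper by (intro Greatest_equality) auto
qed

theorem theorem9:
  fixes P :: "'a set" and R :: "'a set set" and f :: "'a set \<Rightarrow> nat"
  assumes "dps_instance P R f"
    and "star_graph P R"
    and "R \<noteq> {}"
  shows "poly_density R f = (\<Sum>e\<in>R. 1 / real (f e))"
proof -
  obtain c where R: "R = {{c, v} | v. v \<in> P - {c}}"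
    using assms(2) unfolding star_graph_def by blast
  have "finite P" and pos: "\<And>e. e \<in> R \<Longrightarrow> 0 < f e"
    using assms(1) by (auto simp: dps_instance_def simple_graph_def)
  \<comment> \<open>\<open>R\<close> is the image of the finite set \<open>P - {c}\<close> under
    \<open>v \<mapsto> {c, v}\<close>.\<close>
  then have "finite R"
    unfolding R by simp
  then show ?thesis
    using poly_density_common_vertex[of R f c] assms(3) pos R by blast
qed

end
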